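(* Let $q>4$. Then the equation $$h\,(h'^2+h^2)^{\frac{q-2}{2}}(h''+h)=1\quad\text{on }\mathbb{S}^1$$ admits at least $\lceil\sqrt{q}\,\rceil-2$ non-constant positive smooth solutions (up to rotation), where $\lceil\sqrt{q}\,\rceil$ is the smallest integer that is greater than or equal to $\sqrt{q}$.
   Context: The unit circle $\mathbb{S}^1$ is parametrized by arc length $\theta\in[0,2\pi]$, so functions on $\mathbb{S}^1$ are $2\pi$-periodic functions of $\theta$; the superscript $'$ denotes $\frac{d}{d\theta}$. Two solutions are identified up to rotation if $h_2(\theta)=h_1(\theta+c)$ for some constant $c$; "at least $N$ solutions up to rotation" means at least $N$ solutions no two of which are rotations of each other. *)

theory Defs
  imports "HOL-Analysis.Analysis"
begin

text \<open>Functions on the unit circle are represented by their lifts along the arc-length parameter,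
  that is, by \<open>2\<pi>\<close>-periodic functions on the whole real line.\<close>

definition on_circle :: "(real \<Rightarrow> real) \<Rightarrow> bool" where
  "on_circle h \<longleftrightarrow> (\<forall>\<theta>. h (\<theta> + 2 * pi) = h \<theta>)"

text \<open>The value of \<^const>\<open>deriv\<close> is arbitrary where no derivative exists; requiring
  differentiability of every iterate makes all the iterates genuine derivatives.\<close>

definition smooth :: "(real \<Rightarrow> real) \<Rightarrow> bool" where
  "smooth h \<longleftrightarrow> (\<forall>n \<theta>. (deriv ^^ n) h differentiable at \<theta>)"

definition rotation_of :: "(real \<Rightarrow> real) \<Rightarrow> (real \<Rightarrow> real) \<Rightarrow> bool" where
  "rotation_of h1 h2 \<longleftrightarrow> (\<exists>c. \<forall>\<theta>. h2 \<theta> = h1 (\<theta> + c))"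

definition positive_smooth_solution :: "real \<Rightarrow> (real \<Rightarrow> real) \<Rightarrow> bool" where
  "positive_smooth_solution q h \<longleftrightarrow>
     on_circle h \<and> smooth h \<and> (\<forall>\<theta>. h \<theta> > 0) \<and>
     (\<forall>\<theta>. h \<theta> * ((deriv h \<theta>)\<^sup>2 + (h \<theta>)\<^sup>2) powr ((q - 2) / 2) * (deriv (deriv h) \<theta> + h \<theta>) = 1)"

end

theory Submission
  imports Defs
begin

text \<open>Put \<open>h = w\<^sup>1\<^sup>/\<^sup>q cos \<phi>\<close> with \<open>tan \<phi> = h'/h\<close>. The equation becomes the Hamiltonian system
  \<open>w' = q tan \<phi>\<close>, \<open>\<phi>' = 1/w - 1\<close> with conserved energy \<open>(w - 1 - ln w) - q ln (cos \<phi>)\<close>. In the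
  coordinates \<open>x\<close>, \<open>y\<close> in which the two summands are \<open>x\<^sup>2/2\<close> and \<open>y\<^sup>2/2\<close>, the orbits are the circles
  \<open>(x, y) = (r sin t, r cos t)\<close>, and the period is the integral of \<open>(dw/dx)(d\<phi>/dy)\<close> over the circle.
  It is continuous in \<open>r\<close>, equals \<open>2\<pi>/\<surd>q\<close> at \<open>r = 0\<close>, and exceeds \<open>\<pi>\<close> for some large \<open>r\<close>. So each
  value \<open>2\<pi>/k\<close> with \<open>2 \<le> k < \<surd>q\<close> is attained at some \<open>r > 0\<close>. Different \<open>k\<close> force different
  \<open>r\<close>, and hence solutions with different maxima, which cannot be rotations of each other.\<close>

section \<open>Inverse functions and Morse coordinates in one variable\<close>

text \<open>Positivity of \<open>f\<close> makes \<open>F\<close> strictly increasing, connectedness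
  of \<open>I\<close> together with \<open>below\<close> and \<open>above\<close> makes it onto the
  line, and the inverse function theorem differentiates \<open>G\<close>. Serves to invert both a
  Morse coordinate and a time function.\<close>

lemma positive_derivative_inverse:
  fixes F f :: "real \<Rightarrow> real"
  assumes I: "open I" "is_interval I"
    and der: "\<And>x. x \<in> I \<Longrightarrow> (F has_real_derivative f x) (at x)"
    and pos: "\<And>x. x \<in> I \<Longrightarrow> 0 < f x"
    and below: "\<And>y. \<exists>x\<in>I. F x \<le> y" and above: "\<And>y. \<exists>x\<in>I. y \<le> F x"
  obtains G where "\<And>y. G y \<in> I" "\<And>y. F (G y) = y" "\<And>x. x \<in> I \<Longrightarrow> G (F x) = x"
    "\<And>y. (G has_real_derivative 1 / f (G y)) (at y)"
proof -
  have seg: "z \<in> I" if "x \<in> I" "y \<in> I" "x \<le> z" "z \<le> y" for x y z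
    using that I(2) unfolding is_interval_1 by blast
  have mono: "F x < F y" if "x \<in> I" "y \<in> I" "x < y" for x y
    using that(3) by (rule DERIV_pos_imp_increasing) (use der pos seg that in blast)
  have inj: "inj_on F I"
    using mono by (intro linorder_inj_onI') (metis less_irrefl)
  have cont: "continuous_on I F"
    by (rule DERIV_continuous_on[where D = f]) (blast intro: has_field_derivative_at_within der)
  have surj: "y \<in> F ` I" for y
  proof -
    obtain a b where "a \<in> I" "F a \<le> y" "b \<in> I" "y \<le> F b"
      using below above by blast
    moreover have "connected (F ` I)"
      using I cont is_interval_connected connected_continuous_image by blast
    ultimately show ?thesis
      by (meson connectedD_interval imageI)
  qed
  define G where "G = inv_into I F"
  have G: "G y \<in> I" "F (G y) = y" for y
    using surj[of y] by (auto simp: G_def inv_into_into f_inv_into_f)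
  have GF: "G (F x) = x" if "x \<in> I" for x
    using that inj by (simp add: G_def)
  have "(G has_real_derivative 1 / f (G y)) (at y)" for y
    unfolding has_field_derivative_def
  proof (rule has_derivative_inverse_strong_x[where f = F and S = I and f' = "(*) (f (G y))"])
    show "(F has_derivative (*) (f (G y))) (at (G y))"
      using der[OF G(1)] by (simp add: has_field_derivative_def)
    show "(*) (f (G y)) \<circ> (*) (1 / f (G y)) = id"
      using pos[OF G(1), of y] by (auto simp: fun_eq_iff)
  qed (use G GF I cont in auto)
  with G GF that show thesis by blast
qed

text \<open>Morse lemma in global form: the signed root \<open>X\<close> of \<open>2 * A\<close>
  maps \<open>I\<close> onto the line with positive continuous derivative, and \<open>W\<close> is
  its inverse. Only the critical point \<open>c\<close> is delicate, where the formula
  \<open>dA w / X w\<close> for the slope becomes 0/0. Continuity of \<open>D\<close> and its value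
  at 0 later control the period near zero amplitude.\<close>

lemma morse_coordinate:
  fixes A dA ddA :: "real \<Rightarrow> real"
  assumes I: "open I" "is_interval I" and c: "c \<in> I"
    and A: "\<And>w. w \<in> I \<Longrightarrow> (A has_real_derivative dA w) (at w)"
    and dA_deriv: "\<And>w. w \<in> I \<Longrightarrow> (dA has_real_derivative ddA w) (at w)"
    and ddA_c: "isCont ddA c" "0 < ddA c"
    and zero: "A c = 0" "dA c = 0"
    and left: "\<And>w. w \<in> I \<Longrightarrow> w < c \<Longrightarrow> dA w < 0"
    and right: "\<And>w. w \<in> I \<Longrightarrow> c < w \<Longrightarrow> 0 < dA w"
    and below: "\<And>y. \<exists>w\<in>I. w < c \<and> y \<le> A w" and above: "\<And>y. \<exists>w\<in>I. c < w \<and> y \<le> A w"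
  obtains W D where "\<And>x. W x \<in> I" "\<And>x. (W has_real_derivative D x) (at x)" "\<And>x. 0 < D x"
    "continuous_on UNIV D" "\<And>x. A (W x) = x\<^sup>2 / 2" "\<And>x. dA (W x) * D x = x"
    "W 0 = c" "D 0 = 1 / sqrt (ddA c)" "\<And>w. w \<in> I \<Longrightarrow> \<exists>x. W x = w"
proof -
  have seg: "z \<in> I" if "x \<in> I" "y \<in> I" "x \<le> z" "z \<le> y" for x y z
    using that I(2) unfolding is_interval_1 by blast
  have contA: "continuous_on J A" if "J \<subseteq> I" for J
    by (rule DERIV_continuous_on[where D = dA]) (use that in \<open>blast intro: has_field_derivative_at_within A\<close>)
  have A_pos: "0 < A w" if w: "w \<in> I" "w \<noteq> c" for w
  proof (cases "w < c")
    case True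
    have "A w > A c"
    proof (rule DERIV_neg_imp_decreasing_open[OF True])
      show "continuous_on {w..c} A"
        by (rule contA) (auto intro: seg[OF w(1) c])
      show "\<exists>y. (A has_real_derivative y) (at x) \<and> y < 0" if "w < x" "x < c" for x
        using A[of x] left[of x] seg[OF w(1) c, of x] that by auto
    qed
    then show ?thesis using zero by simp
  next
    case False
    then have "c < w" using w by simp
    then have "A c < A w"
    proof (rule DERIV_pos_imp_increasing_open)
      show "continuous_on {c..w} A"
        by (rule contA) (auto intro: seg[OF c w(1)])
      show "\<exists>y. (A has_real_derivative y) (at x) \<and> 0 < y" if "c < x" "x < w" for x
        using A[of x] right[of x] seg[OF c w(1), of x] that by auto
    qed
    then show ?thesis using zero by simp
  qed
  have dA_ne: "dA w \<noteq> 0" if w: "w \<in> I" "w \<noteq> c" for w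
    using left[OF w(1)] right[OF w(1)] w(2) by linarith
  have near: "\<forall>\<^sub>F w in at c. w \<in> I \<and> w \<noteq> c"
    using I(1) c eventually_at_topological by blast
  \<comment> \<open>The change of sign turns the corner of \<open>sqrt (2 * A w)\<close> at
    \<open>c\<close> into a crossing with positive slope.\<close>
  define X where "X w = (if w < c then - sqrt (2 * A w) else sqrt (2 * A w))" for w
  \<comment> \<open>Candidate for the derivative of \<open>X\<close>: off \<open>c\<close> it comes
    from differentiating the identity \<open>X_sq\<close>, and at \<open>c\<close> it is the limit
    value.\<close>
  define X1 where "X1 w = (if w = c then sqrt (ddA c) else dA w / X w)" for w
  have X_sq: "(X w)\<^sup>2 = 2 * A w" if "w \<in> I" for w
    using A_pos[OF that] zero by (cases "w = c") (auto simp: X_def)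
  have X_sgn: "w < c \<Longrightarrow> X w < 0" "c < w \<Longrightarrow> 0 < X w" if "w \<in> I" for w
    using A_pos[OF that] by (auto simp: X_def)
  have X_c: "X c = 0" by (simp add: X_def zero)
  have dA_eq: "X1 w * X w = dA w" if "w \<in> I" for w
    using X_sgn[OF that] zero X_c by (cases w c rule: linorder_cases) (simp_all add: X1_def)
  have X1_pos: "0 < X1 w" if "w \<in> I" for w
    using X_sgn[OF that] left[OF that] right[OF that] ddA_c
    by (cases w c rule: linorder_cases) (simp_all add: X1_def divide_neg_neg)
  have cont_dA: "continuous_on I dA"
    by (rule DERIV_continuous_on[where D = ddA]) (blast intro: has_field_derivative_at_within dA_deriv)
  have limA: "(A \<longlongrightarrow> 0) (at c)"
    using DERIV_isCont[OF A[OF c]] zero by (simp add: isCont_def)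
  have lim_dA: "(dA \<longlongrightarrow> 0) (at c)"
    using DERIV_isCont[OF dA_deriv[OF c]] zero by (simp add: isCont_def)
  \<comment> \<open>This quotient is the square of \<open>X1\<close>. As \<open>X1\<close> is
    positive, the limit found by l'Hopital gives continuity of \<open>X1\<close> at
    \<open>c\<close>.\<close>
  have "((\<lambda>w. (dA w)\<^sup>2 / (2 * A w)) \<longlongrightarrow> ddA c) (at c)"
  proof (rule lhopital)
    show "((\<lambda>w. (dA w)\<^sup>2) \<longlongrightarrow> 0) (at c)" "((\<lambda>w. 2 * A w) \<longlongrightarrow> 0) (at c)"
      using tendsto_power[OF lim_dA, of 2] tendsto_mult_right_zero[OF limA] by auto
    show "\<forall>\<^sub>F w in at c. 2 * A w \<noteq> 0"
      using near by eventually_elim (use A_pos in fastforce)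
    show "\<forall>\<^sub>F w in at c. 2 * dA w \<noteq> 0"
      using near by eventually_elim (simp add: dA_ne)
    show "\<forall>\<^sub>F w in at c. ((\<lambda>w. (dA w)\<^sup>2) has_real_derivative 2 * dA w * ddA w) (at w)"
      using near by eventually_elim (auto intro!: derivative_eq_intros dA_deriv)
    show "\<forall>\<^sub>F w in at c. ((\<lambda>w. 2 * A w) has_real_derivative 2 * dA w) (at w)"
      using near by eventually_elim (auto intro!: derivative_eq_intros A)
    have "\<forall>\<^sub>F w in at c. 2 * dA w * ddA w / (2 * dA w) = ddA w"
      using near by eventually_elim (simp add: dA_ne)
    then show "((\<lambda>w. 2 * dA w * ddA w / (2 * dA w)) \<longlongrightarrow> ddA c) (at c)"
      using ddA_c(1) by (simp add: isCont_def tendsto_cong)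
  qed
  then have "((\<lambda>w. sqrt ((dA w)\<^sup>2 / (2 * A w))) \<longlongrightarrow> sqrt (ddA c)) (at c)"
    by (rule tendsto_real_sqrt)
  moreover have "\<forall>\<^sub>F w in at c. sqrt ((dA w)\<^sup>2 / (2 * A w)) = X1 w"
    using near
  proof eventually_elim
    case (elim w)
    then have "(X1 w)\<^sup>2 = (dA w)\<^sup>2 / (2 * A w)"
      using X_sq[of w] by (simp add: X1_def power_divide)
    then show ?case
      using X1_pos[of w] elim by (metis less_imp_le real_sqrt_unique)
  qed
  ultimately have "(X1 \<longlongrightarrow> sqrt (ddA c)) (at c)"
    by (simp add: tendsto_cong)
  then have X1_cont_c: "isCont X1 c"
    by (simp add: isCont_def X1_def)
  \<comment> \<open>Since \<open>X w\<close> and \<open>w - c\<close> have the same sign, the root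
    of this quotient is the difference quotient of \<open>X\<close> at \<open>c\<close>. L'Hopital
    reduces it to the difference quotient of \<open>dA\<close>.\<close>
  have "((\<lambda>w. 2 * A w / (w - c)\<^sup>2) \<longlongrightarrow> ddA c) (at c)"
  proof (rule lhopital)
    show "((\<lambda>w. 2 * A w) \<longlongrightarrow> 0) (at c)" 
      using tendsto_mult_right_zero[OF limA] by auto
    show "((\<lambda>w. (w - c)\<^sup>2) \<longlongrightarrow> 0) (at c)"
      by (auto intro!: tendsto_eq_intros)
    show "\<forall>\<^sub>F w in at c. (w - c)\<^sup>2 \<noteq> 0" "\<forall>\<^sub>F w in at c. 2 * (w - c) \<noteq> 0"
      using near by (auto elim: eventually_mono)
    show "\<forall>\<^sub>F w in at c. ((\<lambda>w. 2 * A w) has_real_derivative 2 * dA w) (at w)"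
      using near by eventually_elim (auto intro!: derivative_eq_intros A)
    show "\<forall>\<^sub>F w in at c. ((\<lambda>w. (w - c)\<^sup>2) has_real_derivative 2 * (w - c)) (at w)"
      by (auto intro!: derivative_eq_intros always_eventually)
    show "((\<lambda>w. 2 * dA w / (2 * (w - c))) \<longlongrightarrow> ddA c) (at c)"
      using dA_deriv[OF c] zero by (simp add: has_field_derivative_iff mult_divide_mult_cancel_left
        del: right_diff_distrib_numeral)
  qed
  then have "((\<lambda>w. sqrt (2 * A w / (w - c)\<^sup>2)) \<longlongrightarrow> sqrt (ddA c)) (at c)"
    by (rule tendsto_real_sqrt)
  moreover have "\<forall>\<^sub>F w in at c. sqrt (2 * A w / (w - c)\<^sup>2) = (X w - X c) / (w - c)"
    using near
  proof eventually_elim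
    case (elim w)
    show ?case
      using elim by (auto simp: X_def zero real_sqrt_divide minus_divide_right)
  qed
  ultimately have "(X has_real_derivative sqrt (ddA c)) (at c)"
    by (simp add: has_field_derivative_iff tendsto_cong)
  then have X_der_c: "(X has_real_derivative X1 c) (at c)" by (simp add: X1_def)
  have X_der: "(X has_real_derivative X1 w) (at w)" if w: "w \<in> I" for w
  proof (cases w c rule: linorder_cases)
    case less
    have "((\<lambda>w. - sqrt (2 * A w)) has_real_derivative X1 w) (at w)"
      using less A_pos[OF w] by (auto intro!: derivative_eq_intros A w simp: X1_def X_def field_simps)
    then show ?thesis
      by (rule has_field_derivative_transform_within_open[where S = "{..<c}"])
        (use less in \<open>auto simp: X_def\<close>)
  next
    case equal
    then show ?thesis using X_der_c by simp
  next
    case greater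
    have "((\<lambda>w. sqrt (2 * A w)) has_real_derivative X1 w) (at w)"
      using greater A_pos[OF w] by (auto intro!: derivative_eq_intros A w simp: X1_def X_def field_simps)
    then show ?thesis
      by (rule has_field_derivative_transform_within_open[where S = "{c<..}"])
        (use greater in \<open>auto simp: X_def\<close>)
  qed
  have X1_cont: "isCont X1 w" if w: "w \<in> I" for w
  proof (cases "w = c")
    case False
    have "X w \<noteq> 0" using X_sgn[OF w] False by (cases w c rule: linorder_cases) simp_all
    then have "isCont (\<lambda>w. dA w / X w) w"
      using DERIV_isCont[OF X_der[OF w]] DERIV_isCont[OF dA_deriv[OF w]] by (intro continuous_intros)
    moreover have "\<forall>\<^sub>F v in nhds w. v \<noteq> c"
      using False by (rule t1_space_nhds)
    then have "\<forall>\<^sub>F v in nhds w. X1 v = dA v / X v"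
      by eventually_elim (simp add: X1_def)
    ultimately show ?thesis by (simp add: isCont_cong)
  qed (use X1_cont_c in simp)
  have X_below: "\<exists>w\<in>I. X w \<le> y" for y
  proof -
    obtain w where w: "w \<in> I" "w < c" "y\<^sup>2 / 2 \<le> A w" using below by blast
    then have "\<bar>y\<bar> \<le> sqrt (2 * A w)" by (intro real_le_rsqrt) simp
    then show ?thesis using w by (intro bexI[of _ w]) (auto simp: X_def)
  qed
  have X_above: "\<exists>w\<in>I. y \<le> X w" for y
  proof -
    obtain w where w: "w \<in> I" "c < w" "y\<^sup>2 / 2 \<le> A w" using above by blast
    then have "\<bar>y\<bar> \<le> sqrt (2 * A w)" by (intro real_le_rsqrt) simp
    then show ?thesis using w by (intro bexI[of _ w]) (auto simp: X_def)
  qed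
  obtain W where W: "\<And>x. W x \<in> I" "\<And>x. X (W x) = x" "\<And>w. w \<in> I \<Longrightarrow> W (X w) = w"
    "\<And>x. (W has_real_derivative 1 / X1 (W x)) (at x)"
    by (rule positive_derivative_inverse[OF I X_der X1_pos X_below X_above], assumption, assumption, rule that)
  show thesis
  proof (rule that[of W "\<lambda>x. 1 / X1 (W x)"])
    have "isCont (\<lambda>x. 1 / X1 (W x)) x" for x
      using isCont_o2[OF DERIV_isCont[OF W(4)] X1_cont[OF W(1)], of x] X1_pos[OF W(1), of x]
      by (intro continuous_intros) auto
    then show "continuous_on UNIV (\<lambda>x. 1 / X1 (W x))"
      by (simp add: continuous_at_imp_continuous_on)
    show "A (W x) = x\<^sup>2 / 2" for x
      using X_sq[OF W(1), of x] W(2) by simp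
    show "dA (W x) * (1 / X1 (W x)) = x" for x
      using dA_eq[OF W(1), of x] X1_pos[OF W(1), of x] W(2) by (simp add: field_simps)
    show W0: "W 0 = c"
      using W(3)[OF c] X_c by simp
    show "1 / X1 (W 0) = 1 / sqrt (ddA c)"
      by (simp add: W0 X1_def)
    show "0 < 1 / X1 (W x)" for x
      using X1_pos[OF W(1)] by simp
    show "\<exists>x. W x = w" if "w \<in> I" for w
      using W(3)[OF that] by blast
  qed (rule W)+
qed

section \<open>Smoothness, and the way back from the system to the equation\<close>

inductive_set polynomials_in :: "(real \<Rightarrow> real) set \<Rightarrow> (real \<Rightarrow> real) set" for G where
  generator: "g \<in> G \<Longrightarrow> g \<in> polynomials_in G"
| const: "(\<lambda>_. c) \<in> polynomials_in G"
| add: "f \<in> polynomials_in G \<Longrightarrow> g \<in> polynomials_in G \<Longrightarrow> (\<lambda>x. f x + g x) \<in> polynomials_in G"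
| mult: "f \<in> polynomials_in G \<Longrightarrow> g \<in> polynomials_in G \<Longrightarrow> (\<lambda>x. f x * g x) \<in> polynomials_in G"

text \<open>The sum and product rules extend closure under differentiation from the generators to
  the whole algebra, so all iterates of \<open>deriv\<close> stay in it and are
  differentiable.\<close>

lemma polynomial_system_smooth:
  assumes G: "\<And>g. g \<in> G \<Longrightarrow> \<exists>g'\<in>polynomials_in G. \<forall>x. (g has_real_derivative g' x) (at x)"
    and f: "f \<in> polynomials_in G"
  shows "smooth f"
proof -
  have der: "\<exists>f'\<in>polynomials_in G. \<forall>x. (f has_real_derivative f' x) (at x)"
    if "f \<in> polynomials_in G" for f
    using that
  proof induction
    case (generator g)
    then show ?case by (rule G)
  next
    case (const c)
    show ?case by (rule bexI[OF _ polynomials_in.const[of 0]]) simp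
  next
    case (add f g)
    then obtain f' g' where "f' \<in> polynomials_in G" "g' \<in> polynomials_in G"
      "\<forall>x. (f has_real_derivative f' x) (at x)" "\<forall>x. (g has_real_derivative g' x) (at x)"
      by blast
    then show ?case
      by (intro bexI[of _ "\<lambda>x. f' x + g' x"] polynomials_in.add) (auto intro!: derivative_intros)
  next
    case (mult f g)
    then obtain f' g' where "f' \<in> polynomials_in G" "g' \<in> polynomials_in G"
      "\<forall>x. (f has_real_derivative f' x) (at x)" "\<forall>x. (g has_real_derivative g' x) (at x)"
      by blast
    with mult.hyps show ?case
      by (intro bexI[of _ "\<lambda>x. f x * g' x + f' x * g x"] polynomials_in.add polynomials_in.mult)
        (auto intro!: derivative_eq_intros)
  qed
  have step: "deriv f \<in> polynomials_in G" if f: "f \<in> polynomials_in G" for f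
  proof -
    obtain f' where f': "f' \<in> polynomials_in G" "\<And>x. (f has_real_derivative f' x) (at x)"
      using der[OF f] by blast
    then have "deriv f = f'" by (auto intro: DERIV_imp_deriv)
    with f' show ?thesis by simp
  qed
  have "(deriv ^^ n) f \<in> polynomials_in G" for n
    by (induction n) (simp_all add: f step)
  with der show ?thesis
    unfolding smooth_def using real_differentiable_def by blast
qed

text \<open>With \<open>R = w x powr (1 / q)\<close> the system gives h' = R sin p, so h'^2 + h^2 =
  R^2, whose power \<open>(q - 2) / 2\<close> is w / R^2. Moreover h'' + h = h / (w cos^2 p), and
  the product with h = R cos p is 1.\<close>

lemma positive_smooth_solution_from_system:
  fixes q :: real and w p :: "real \<Rightarrow> real"
  assumes q: "q > 0"
    and w_pos: "\<And>x. w x > 0" and cos_pos: "\<And>x. cos (p x) > 0"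
    and w': "\<And>x. (w has_real_derivative q * tan (p x)) (at x)"
    and p': "\<And>x. (p has_real_derivative 1 / w x - 1) (at x)"
    and per: "\<And>x. w (x + 2 * pi) = w x" "\<And>x. p (x + 2 * pi) = p x"
  shows "positive_smooth_solution q (\<lambda>x. w x powr (1 / q) * cos (p x))"
proof -
  define h where "h x = w x powr (1 / q) * cos (p x)" for x
  \<comment> \<open>In the unknowns \<open>h\<close>, \<open>t\<close>, \<open>z\<close> the system
    is polynomial; taking the reciprocal of \<open>w\<close> as an unknown removes the
    division.\<close>
  define t where "t x = tan (p x)" for x
  define z where "z x = 1 / w x" for x
  have h_pos: "h x > 0" for x
    using w_pos[of x] cos_pos[of x] by (simp add: h_def)
  have sec: "1 + (t x)\<^sup>2 = inverse ((cos (p x))\<^sup>2)" for x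
    using tan_sec[of "p x"] cos_pos[of x] by (simp add: t_def power_inverse)
  have h': "(h has_real_derivative h x * t x) (at x)" for x
  proof -
    have "w x powr ((1 - q) / q) = w x powr (1 / q) / w x"
      using w_pos[of x] q by (simp add: diff_divide_distrib powr_diff)
    then show ?thesis
      unfolding h_def t_def using w_pos[of x] cos_pos[of x] q
      by (auto intro!: derivative_eq_intros w' p' simp: tan_def field_simps)
  qed
  have t': "(t has_real_derivative (1 + (t x)\<^sup>2) * (z x - 1)) (at x)" for x
    unfolding sec unfolding t_def z_def using cos_pos[of x]
    by (auto intro!: derivative_eq_intros p')
  have z': "(z has_real_derivative - q * (z x)\<^sup>2 * t x) (at x)" for x
    unfolding t_def z_def using w_pos[of x]
    by (auto intro!: derivative_eq_intros w' simp: power2_eq_square field_simps)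
  have "smooth h"
  proof (rule polynomial_system_smooth[where G = "{h, t, z}"])
    let ?P = "polynomials_in {h, t, z}"
    have gen: "h \<in> ?P" "t \<in> ?P" "z \<in> ?P"
      by (simp_all add: polynomials_in.generator)
    note intros = polynomials_in.intros(2-4)[of _ "{h, t, z}"] gen
    have "(\<lambda>x. h x * t x) \<in> ?P"
      by (intro intros)
    moreover have "(\<lambda>x. (1 + t x * t x) * (z x + - 1)) \<in> ?P"
      by (intro intros)
    moreover have "(\<lambda>x. - q * (z x * z x) * t x) \<in> ?P"
      by (intro intros)
    ultimately show "\<exists>g'\<in>?P. \<forall>x. (g has_real_derivative g' x) (at x)" if "g \<in> {h, t, z}" for g
      using that h' t' z' by (fastforce simp: power2_eq_square)
    show "h \<in> ?P" by (rule gen)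
  qed
  moreover have "on_circle h"
    by (simp add: on_circle_def h_def per)
  moreover have "h x * ((deriv h x)\<^sup>2 + (h x)\<^sup>2) powr ((q - 2) / 2) * (deriv (deriv h) x + h x) = 1" for x
  proof -
    have dh: "deriv h = (\<lambda>x. h x * t x)"
      using h' by (auto intro: DERIV_imp_deriv)
    have ddh: "deriv (deriv h) x = h x * (t x)\<^sup>2 + h x * ((1 + (t x)\<^sup>2) * (z x - 1))"
      unfolding dh by (rule DERIV_imp_deriv)
        (auto intro!: derivative_eq_intros h' t' simp: power2_eq_square)
    define R where "R = w x powr (1 / q)"
    have R: "R > 0" "R powr q = w x"
      using w_pos[of x] q by (auto simp: R_def powr_powr)
    have hR: "h x = R * cos (p x)" by (simp add: h_def R_def)
    have "(deriv h x)\<^sup>2 + (h x)\<^sup>2 = (h x)\<^sup>2 * (1 + (t x)\<^sup>2)"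
      by (simp add: dh algebra_simps power_mult_distrib)
    also have "\<dots> = R\<^sup>2"
      using cos_pos[of x] by (simp add: hR sec power_mult_distrib)
    also have "\<dots> powr ((q - 2) / 2) = R powr (q - 2)"
      using R(1) powr_powr[of R 2 "(q - 2) / 2"] by (simp add: diff_divide_distrib)
    also have "\<dots> = w x / R\<^sup>2"
      using R by (simp add: powr_diff)
    finally have A: "((deriv h x)\<^sup>2 + (h x)\<^sup>2) powr ((q - 2) / 2) = w x / R\<^sup>2" .
    have B: "deriv (deriv h) x + h x = h x * (1 + (t x)\<^sup>2) * z x"
      by (simp add: ddh algebra_simps)
    show ?thesis
      unfolding A B unfolding sec hR z_def using R(1) cos_pos[of x] w_pos[of x]
      by (simp add: field_simps power2_eq_square)
  qed
  ultimately show ?thesis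
    unfolding positive_smooth_solution_def h_def[symmetric] using h_pos by blast
qed

section \<open>Time as a function of the angle, and its inverse\<close>

text \<open>An antiderivative \<open>F\<close> of \<open>g\<close> is time as a function of the
  angle, and \<open>\<tau>\<close> is its inverse. One turn \<open>L\<close> of the angle takes the
  time \<open>integral {0..L} g\<close>.\<close>

lemma periodic_time_change:
  fixes g :: "real \<Rightarrow> real"
  assumes cont: "continuous_on UNIV g" and pos: "\<And>t. 0 < g t"
    and per: "\<And>t. g (t + L) = g t" and L: "0 < L"
  obtains \<tau> where "\<And>y. (\<tau> has_real_derivative 1 / g (\<tau> y)) (at y)"
    "\<And>y. \<tau> (y + integral {0..L} g) = \<tau> y + L" "surj \<tau>"
proof -
  obtain F where F: "\<And>t. (F has_real_derivative g t) (at t)"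
    using einterval_antiderivative[of "-\<infinity>" "\<infinity>" g] cont
    by (auto simp: continuous_on_eq_continuous_at has_real_derivative_iff_has_vector_derivative)
  define T where "T = integral {0..L} g"
  have "(g has_integral F L - F 0) {0..L}"
  proof (rule fundamental_theorem_of_calculus)
    show "(F has_vector_derivative g x) (at x within {0..L})" for x
      using has_field_derivative_at_within[OF F]
      by (simp add: has_real_derivative_iff_has_vector_derivative)
  qed (use L in simp)
  then have T: "T = F L - F 0" by (simp add: T_def integral_unique)
  have "F 0 < F L"
    by (rule DERIV_pos_imp_increasing[OF L]) (intro exI conjI, rule F, rule pos)
  then have T_pos: "0 < T" by (simp add: T)
  \<comment> \<open>Periodicity of \<open>g\<close> makes the increment of \<open>F\<close> over one
    turn constant.\<close>
  have "((\<lambda>t. F (t + L) - F t) has_real_derivative 0) (at t)" for t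
  proof -
    have "((\<lambda>t. F (t + L)) has_real_derivative g t) (at t)"
      using F[of "t + L"] by (simp add: DERIV_shift per)
    from DERIV_diff[OF this F[of t]] show ?thesis by simp
  qed
  then have "F (t + L) - F t = F (0 + L) - F 0" for t
    using DERIV_isconst_all[of "\<lambda>t. F (t + L) - F t" t 0] by simp
  then have shift: "F (t + L) = F t + T" for t
    using T by (metis add.commute add_0 diff_add_cancel)
  \<comment> \<open>Repeated shifts by the positive \<open>T\<close> make \<open>F\<close> unbounded
    in both directions, as its inversion requires.\<close>
  have shifts: "F (t + n * L) = F t + n * T" for t and n :: nat
  proof (induction n)
    case (Suc n)
    then show ?case using shift[of "t + n * L"] by (simp add: algebra_simps)
  qed simp
  have below: "\<exists>t\<in>UNIV. F t \<le> y" for y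
  proof -
    obtain n :: nat where "F 0 - y \<le> n * T"
      using reals_Archimedean3[OF T_pos] less_imp_le by blast
    then show ?thesis using shifts[of "- (n * L)" n] by (intro bexI[of _ "- (n * L)"]) auto
  qed
  have above: "\<exists>t\<in>UNIV. y \<le> F t" for y
  proof -
    obtain n :: nat where "y - F 0 \<le> n * T"
      using reals_Archimedean3[OF T_pos] less_imp_le by blast
    then show ?thesis using shifts[of 0 n] by (intro bexI[of _ "n * L"]) auto
  qed
  obtain \<tau> where \<tau>: "\<And>y. F (\<tau> y) = y" "\<And>t. \<tau> (F t) = t"
    "\<And>y. (\<tau> has_real_derivative 1 / g (\<tau> y)) (at y)"
    by (rule positive_derivative_inverse[OF open_UNIV is_interval_univ F pos below above])
      (rule that, simp_all)
  have \<tau>_shift: "\<tau> (y + integral {0..L} g) = \<tau> y + L" for y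
    using \<tau>(2)[of "\<tau> y + L"] by (simp add: shift \<tau>(1) T_def)
  have "surj \<tau>"
    by (rule surjI[of \<tau> F]) (rule \<tau>(2))
  then show thesis
    by (rule that[OF \<tau>(3) \<tau>_shift])
qed

section \<open>The oscillator: its period, and solutions from its orbits\<close>

text \<open>Cosine is concave on [0, pi/2] and so lies above its chord 1 - 2x/pi. A small cosine
  thus forces an angle close to pi/2.\<close>

lemma acute_angle_ge:
  fixes x :: real
  assumes "0 \<le> x" "x \<le> pi / 2"
  shows "pi / 2 * (1 - cos x) \<le> x"
proof -
  have "concave_on {0..pi / 2} cos"
  proof (rule f''_le0_imp_concave[where f' = "\<lambda>x. - sin x" and f'' = "\<lambda>x. - cos x"])
    show "(cos has_real_derivative - sin x) (at x)" for x :: real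
      by (rule DERIV_cos)
    show "((\<lambda>x. - sin x) has_real_derivative - cos x) (at x)" for x :: real
      by (rule DERIV_minus[OF DERIV_sin])
    show "- cos x \<le> 0" if "x \<in> {0..pi / 2}" for x
      using that by (simp add: cos_ge_zero)
  qed auto
  then have "cos ((1 - 2 * x / pi) *\<^sub>R 0 + (2 * x / pi) *\<^sub>R (pi / 2))
      \<ge> (1 - 2 * x / pi) * cos 0 + 2 * x / pi * cos (pi / 2)"
    using assms by (intro concave_onD) (auto simp: field_simps)
  then show ?thesis by (simp add: field_simps)
qed

text \<open>\<open>W\<close> and \<open>\<Phi>\<close> express \<open>w\<close> and \<open>\<phi>\<close> in the coordinates \<open>x\<close> and \<open>y\<close>; \<open>D\<close> and \<open>E\<close> are their derivatives.\<close>

locale oscillator =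
  fixes q :: real and W D \<Phi> E :: "real \<Rightarrow> real"
  assumes q_pos: "q > 0"
    and W_pos: "\<And>x. 0 < W x" and W_deriv: "\<And>x. (W has_real_derivative D x) (at x)"
    and D_pos: "\<And>x. 0 < D x" and D_cont: "continuous_on UNIV D"
    and W_energy: "\<And>x. W x - 1 - ln (W x) = x\<^sup>2 / 2"
    and W_D: "\<And>x. (1 - 1 / W x) * D x = x"
    and W_0: "W 0 = 1" and D_0: "D 0 = 1" and W_surj: "\<And>w. 0 < w \<Longrightarrow> \<exists>x. W x = w"
    and Phi_bounds: "\<And>y. - (pi / 2) < \<Phi> y" "\<And>y. \<Phi> y < pi / 2"
    and Phi_deriv: "\<And>y. (\<Phi> has_real_derivative E y) (at y)"
    and E_pos: "\<And>y. 0 < E y" and E_cont: "continuous_on UNIV E"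
    and Phi_energy: "\<And>y. - q * ln (cos (\<Phi> y)) = y\<^sup>2 / 2"
    and Phi_E: "\<And>y. q * tan (\<Phi> y) * E y = y"
    and Phi_0: "\<Phi> 0 = 0" and E_0: "E 0 = 1 / sqrt q"
begin

text \<open>By \<open>W_D\<close> and \<open>Phi_E\<close>, on (x, y) = (r sin t, r cos t) the
  system reduces to t' = 1 / (D x E y). Integrating the reciprocal gives the time of one
  turn.\<close>

definition period :: "real \<Rightarrow> real" where
  "period r = integral {0..2 * pi} (\<lambda>s. D (r * sin s) * E (r * cos s))"

lemma W_less: "x < y \<Longrightarrow> W x < W y"
  by (erule DERIV_pos_imp_increasing) (intro exI conjI, rule W_deriv, rule D_pos)

lemma W_le: "x \<le> y \<Longrightarrow> W x \<le> W y"
  using W_less by (cases "x = y") (auto simp: less_le)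

lemma Phi_less: "x < y \<Longrightarrow> \<Phi> x < \<Phi> y"
  by (erule DERIV_pos_imp_increasing) (intro exI conjI, rule Phi_deriv, rule E_pos)

lemma cos_Phi: "cos (\<Phi> y) > 0"
  using Phi_bounds by (simp add: cos_gt_zero_pi)

lemma continuous_on_D [continuous_intros]: "continuous_on S f \<Longrightarrow> continuous_on S (\<lambda>x. D (f x))"
  using continuous_on_compose2[OF D_cont] by blast

lemma continuous_on_E [continuous_intros]: "continuous_on S f \<Longrightarrow> continuous_on S (\<lambda>x. E (f x))"
  using continuous_on_compose2[OF E_cont] by blast

lemma period_0: "period 0 = 2 * pi / sqrt q"
  by (simp add: period_def D_0 E_0)

lemma continuous_period: "continuous_on UNIV period"
proof -
  have "continuous_on (UNIV \<times> cbox 0 (2 * pi)) (\<lambda>(r, s). D (r * sin s) * E (r * cos s))"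
    unfolding split_beta by (intro continuous_intros)
  then show ?thesis
    unfolding period_def using integral_continuous_on_param[of UNIV 0 "2 * pi"] by auto
qed

text \<open>On the half circle \<open>x > 0\<close> one has \<open>D x = x/(1 - 1/W x) \<ge> x/(1 - 1/M)\<close> with \<open>M = W r\<close>, while
  \<open>\<Phi>\<close> falls short of \<open>\<plusminus>\<pi>/2\<close> at \<open>\<plusminus>r\<close> by a relative error below \<open>1/M\<close>, since \<open>cos (\<Phi> r)\<close> decays
  exponentially in \<open>M\<close>. The other half circle contributes a positive amount.\<close>

lemma period_gt_pi: "\<exists>r>0. pi < period r"
proof -
  \<comment> \<open>For M > 2 the bound on ln M / M yields (q + 1) ln M < M/2 < M - 1.\<close>
  have "\<forall>\<^sub>F M in at_top. ln M / M < 1 / (2 * (q + 1)) \<and> 2 < (M::real)"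
    using q_pos by (intro eventually_conj order_tendstoD(2)[OF ln_x_over_x_tendsto_0] eventually_gt_at_top) auto
  then obtain M where "ln M / M < 1 / (2 * (q + 1))" "2 < M"
    using eventually_happens' trivial_limit_at_top_linorder by blast
  then have M: "M > 1" "(q + 1) * ln M < M - 1"
    using q_pos by (auto simp: field_simps)
  obtain r where r: "W r = M" using W_surj[of M] M by auto
  have r_pos: "0 < r"
    using W_le[of r 0] M W_0 r by force
  \<comment> \<open>The hypothesis covers both \<open>r\<close> and \<open>- r\<close>. Equal
    energies give -q ln cos = M - 1 - ln M, which exceeds q ln M by the choice of
    \<open>M\<close>.\<close>
  have cos_lt: "cos (\<Phi> y) < 1 / M" if "y\<^sup>2 = r\<^sup>2" for y
  proof -
    have "- q * ln (cos (\<Phi> y)) = M - 1 - ln M"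
      using Phi_energy[of y] W_energy[of r] r that by simp
    then have "q * ln (cos (\<Phi> y)) < q * (- ln M)"
      using M(2) by (simp add: algebra_simps)
    then have "ln (cos (\<Phi> y)) < - ln M"
      using mult_less_cancel_left_pos[OF q_pos] by blast
    then have "ln (cos (\<Phi> y)) < ln (1 / M)"
      using M(1) by (simp add: ln_div)
    then show ?thesis using cos_Phi[of y] M(1) by simp
  qed
  have "pi / 2 * (1 - 1 / M) < \<Phi> r"
  proof -
    have "pi / 2 * (1 - 1 / M) < pi / 2 * (1 - cos (\<Phi> r))"
      using cos_lt[of r] by simp
    also have "\<dots> \<le> \<Phi> r"
      using Phi_less[OF r_pos] Phi_bounds[of r] Phi_0 by (intro acute_angle_ge) auto
    finally show ?thesis .
  qed
  moreover have "pi / 2 * (1 - 1 / M) < - \<Phi> (- r)"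
  proof -
    have "pi / 2 * (1 - 1 / M) < pi / 2 * (1 - cos (- \<Phi> (- r)))"
      using cos_lt[of "- r"] by simp
    also have "\<dots> \<le> - \<Phi> (- r)"
      using Phi_less[of "- r" 0] r_pos Phi_bounds(1)[of "- r"] Phi_0 by (intro acute_angle_ge) auto
    finally show ?thesis .
  qed
  ultimately have angle: "pi * (1 - 1 / M) < \<Phi> r - \<Phi> (- r)" by simp
  define c where "c = 1 / (1 - 1 / M)"
  have c: "0 < c" using M(1) by (simp add: c_def)
  let ?g = "\<lambda>s. D (r * sin s) * E (r * cos s)"
  let ?k = "\<lambda>s. c * (r * sin s * E (r * cos s))"
  have int_g: "?g integrable_on {a..b}" for a b
    by (intro integrable_continuous_interval continuous_intros)
  \<comment> \<open>The lower bound \<open>?k\<close> is an exact derivative, so its integral over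
    the half circle is the angle swept by \<open>\<Phi>\<close>, times \<open>c\<close>.\<close>
  have "((\<lambda>s. c * - \<Phi> (r * cos s)) has_real_derivative ?k s) (at s within A)" for s A
  proof (rule has_field_derivative_at_within)
    have "((\<lambda>s. \<Phi> (r * cos s)) has_real_derivative E (r * cos s) * (r * - sin s)) (at s)"
      by (rule DERIV_chain2[OF Phi_deriv]) (intro DERIV_cmult DERIV_cos)
    from DERIV_cmult[OF DERIV_minus[OF this], of c]
    show "((\<lambda>s. c * - \<Phi> (r * cos s)) has_real_derivative ?k s) (at s)"
      by (simp add: mult_ac)
  qed
  then have "(?k has_integral c * - \<Phi> (r * cos pi) - c * - \<Phi> (r * cos 0)) {0..pi}"
    by (intro fundamental_theorem_of_calculus)
      (simp_all add: has_real_derivative_iff_has_vector_derivative)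
  then have int_k: "(?k has_integral c * (\<Phi> r - \<Phi> (- r))) {0..pi}"
    by (simp add: algebra_simps)
  have "pi = c * (pi * (1 - 1 / M))"
    using M(1) by (simp add: c_def)
  also have "\<dots> < c * (\<Phi> r - \<Phi> (- r))"
    using angle c by simp
  also have "\<dots> = integral {0..pi} ?k"
    by (rule integral_unique[OF int_k, symmetric])
  also have "\<dots> \<le> integral {0..pi} ?g"
  proof (rule integral_le)
    show "?k s \<le> ?g s" if "s \<in> {0..pi}" for s
    proof -
      define x where "x = r * sin s"
      have "0 \<le> sin s" using that by (simp add: sin_ge_zero)
      then have x: "0 \<le> x" "x \<le> r" using r_pos by (auto simp: x_def mult_le_cancel_left1)
      have "c * x \<le> D x"
      proof (cases "x = 0")
        case False
        then have W: "1 < W x" "W x \<le> M"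
          using W_less[of 0 x] W_le[of x r] x r W_0 by auto
        have "x = (1 - 1 / W x) * D x" by (simp add: W_D)
        also have "\<dots> \<le> (1 - 1 / M) * D x"
          using W D_pos[of x] by (intro mult_right_mono) (auto simp: frac_le)
        finally show ?thesis using M(1) by (simp add: c_def field_simps)
      qed (use D_pos[of x] in simp)
      then show ?thesis
        using E_pos[of "r * cos s"] by (simp add: x_def mult.assoc[symmetric])
    qed
  qed (rule has_integral_integrable[OF int_k], rule int_g)
  also have "\<dots> \<le> period r"
    unfolding period_def using int_g less_imp_le[OF D_pos] less_imp_le[OF E_pos]
    by (intro integral_subset_le) auto
  finally show ?thesis using r_pos by blast
qed

text \<open>At angle pi/2 the factor \<open>w\<close> is largest and the cosine is 1, which gives
  the maximum of \<open>h\<close>; at -pi/2 the value is strictly smaller, so \<open>h\<close> is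
  not constant. The maximum is recorded because rotations preserve it.\<close>

lemma solution_of_period:
  assumes r: "0 < r" and k: "real k * period r = 2 * pi"
  obtains h where "positive_smooth_solution q h" "\<not> h constant_on UNIV"
    "\<And>x. h x \<le> W r powr (1 / q)" "\<exists>x. h x = W r powr (1 / q)"
proof -
  let ?g = "\<lambda>s. D (r * sin s) * E (r * cos s)"
  have "continuous_on UNIV ?g" by (intro continuous_intros)
  then obtain \<tau> where \<tau>: "\<And>y. (\<tau> has_real_derivative 1 / ?g (\<tau> y)) (at y)"
      "\<And>y. \<tau> (y + period r) = \<tau> y + 2 * pi" "surj \<tau>"
    using periodic_time_change[of ?g "2 * pi"] D_pos E_pos
    by (auto simp: period_def)
  define w where "w x = W (r * sin (\<tau> x))" for x
  define p where "p x = \<Phi> (r * cos (\<tau> x))" for x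
  define h where "h x = w x powr (1 / q) * cos (p x)" for x
  \<comment> \<open>Taking \<open>n = k\<close> gives period 2 pi, since \<open>k\<close> turns fill
    the circle.\<close>
  have "w (x + n * period r) = w x \<and> p (x + n * period r) = p x" for x and n :: nat
  proof (induction n)
    case (Suc n)
    have step: "x + Suc n * period r = (x + n * period r) + period r"
      by (simp add: algebra_simps)
    show ?case
      using Suc \<tau>(2)[of "x + n * period r"] unfolding step by (simp add: w_def p_def)
  qed simp
  then have per: "w (x + 2 * pi) = w x" "p (x + 2 * pi) = p x" for x
    using k by metis+
  have w': "(w has_real_derivative q * tan (p x)) (at x)" for x
  proof -
    have "(w has_real_derivative D (r * sin (\<tau> x)) * (r * (cos (\<tau> x) * (1 / ?g (\<tau> x))))) (at x)"
      unfolding w_def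
      by (rule DERIV_chain2[OF W_deriv]) (intro DERIV_cmult DERIV_chain2[OF DERIV_sin] \<tau>(1))
    also have "D (r * sin (\<tau> x)) * (r * (cos (\<tau> x) * (1 / ?g (\<tau> x))))
        = r * cos (\<tau> x) / E (r * cos (\<tau> x))"
      using D_pos[of "r * sin (\<tau> x)"] by simp
    also have "\<dots> = q * tan (p x)"
      using Phi_E[of "r * cos (\<tau> x)"] E_pos[of "r * cos (\<tau> x)"] by (simp add: p_def field_simps)
    finally show ?thesis .
  qed
  have p': "(p has_real_derivative 1 / w x - 1) (at x)" for x
  proof -
    have "(p has_real_derivative E (r * cos (\<tau> x)) * (r * (- sin (\<tau> x) * (1 / ?g (\<tau> x))))) (at x)"
      unfolding p_def
      by (rule DERIV_chain2[OF Phi_deriv]) (intro DERIV_cmult DERIV_chain2[OF DERIV_cos] \<tau>(1))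
    also have "E (r * cos (\<tau> x)) * (r * (- sin (\<tau> x) * (1 / ?g (\<tau> x))))
        = - (r * sin (\<tau> x)) / D (r * sin (\<tau> x))"
      using E_pos[of "r * cos (\<tau> x)"] by simp
    also have "\<dots> = 1 / w x - 1"
    proof -
      have "r * sin (\<tau> x) / D (r * sin (\<tau> x)) = 1 - 1 / w x"
        using W_D[of "r * sin (\<tau> x)"] D_pos[of "r * sin (\<tau> x)"]
        by (metis less_irrefl nonzero_mult_div_cancel_right w_def)
      then show ?thesis by simp
    qed
    finally show ?thesis .
  qed
  have solution: "positive_smooth_solution q h"
    unfolding h_def
    by (rule positive_smooth_solution_from_system[OF q_pos _ _ w' p' per])
      (simp_all add: w_def p_def W_pos cos_Phi)
  have h_le: "h x \<le> W r powr (1 / q)" for x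
  proof -
    have "h x \<le> w x powr (1 / q)"
      by (simp add: h_def mult_left_le)
    also have "\<dots> \<le> W r powr (1 / q)"
      using r q_pos W_pos by (auto simp: w_def mult_left_le less_imp_le intro!: powr_mono2 W_le)
    finally show ?thesis .
  qed
  obtain x where x: "\<tau> x = pi / 2" using \<tau>(3) by (metis surjD)
  have hx: "h x = W r powr (1 / q)"
    unfolding h_def w_def p_def x by (simp add: Phi_0)
  obtain y where y: "\<tau> y = - (pi / 2)" using \<tau>(3) by (metis surjD)
  have hy: "h y = W (- r) powr (1 / q)"
    unfolding h_def w_def p_def y by (simp add: Phi_0)
  have "h y < h x"
    unfolding hx hy using r q_pos W_pos by (intro powr_less_mono2 W_less) (auto simp: less_imp_le)
  then have "\<not> h constant_on UNIV"
    unfolding constant_on_def by (metis UNIV_I less_irrefl)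
  with solution show thesis
    by (rule that[OF _ _ h_le]) (use hx in blast)
qed

end

section \<open>Existence of the oscillator coordinates\<close>

text \<open>\<open>morse_coordinate\<close> is applied to each summand of the energy: to w - 1 - ln
  w at its minimum 1, with second derivative 1, and to -q ln cos at its minimum 0, with second
  derivative \<open>q\<close>.\<close>

lemma oscillator_exists:
  fixes q :: real
  assumes q: "q > 0"
  obtains W D \<Phi> E where "oscillator q W D \<Phi> E"
proof -
  have W_above: "\<exists>w\<in>{0<..}. 1 < w \<and> y \<le> w - 1 - ln w" for y :: real
  proof -
    \<comment> \<open>Here ln w < w/2, so the energy exceeds w/2 - 1, hence
      \<open>\<bar>y\<bar>\<close>.\<close>
    have "\<forall>\<^sub>F w in at_top. ln w / w < 1 / 2 \<and> max 1 (2 * (\<bar>y\<bar> + 1)) < (w::real)"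
      by (intro eventually_conj order_tendstoD(2)[OF ln_x_over_x_tendsto_0] eventually_gt_at_top) auto
    then obtain w :: real where "ln w / w < 1 / 2" "max 1 (2 * (\<bar>y\<bar> + 1)) < w"
      using eventually_happens' trivial_limit_at_top_linorder by blast
    then show ?thesis by (intro bexI[of _ w]) (auto simp: field_simps)
  qed
  have W_below: "\<exists>w\<in>{0<..}. w < 1 \<and> y \<le> w - 1 - ln w" for y :: real
    by (rule bexI[of _ "exp (- (\<bar>y\<bar> + 1))"]) (use exp_gt_zero[of "- (\<bar>y\<bar> + 1)"] in \<open>auto simp del: exp_gt_zero\<close>)
  obtain W D where W: "\<And>x. W x \<in> {0<..}" "\<And>x. (W has_real_derivative D x) (at x)" "\<And>x. 0 < D x"
    "continuous_on UNIV D" "\<And>x. W x - 1 - ln (W x) = x\<^sup>2 / 2" "\<And>x. (1 - 1 / W x) * D x = x"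
    "W 0 = 1" "D 0 = 1 / sqrt (1 / 1\<^sup>2)" "\<And>w. w \<in> {0<..} \<Longrightarrow> \<exists>x. W x = w"
  proof (rule morse_coordinate[where I = "{0<..}" and c = 1 and A = "\<lambda>w. w - 1 - ln w"
        and dA = "\<lambda>w. 1 - 1 / w" and ddA = "\<lambda>w. 1 / w\<^sup>2"])
    show "((\<lambda>w. w - 1 - ln w) has_real_derivative 1 - 1 / w) (at w)" if "w \<in> {0<..}" for w :: real
      using that by (auto intro!: derivative_eq_intros)
    show "((\<lambda>w. 1 - 1 / w) has_real_derivative 1 / w\<^sup>2) (at w)" if "w \<in> {0<..}" for w :: real
      using that by (auto intro!: derivative_eq_intros simp: power2_eq_square)
    show "isCont (\<lambda>w. 1 / w\<^sup>2) (1::real)"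
      by (intro continuous_intros) simp
    show "\<exists>w\<in>{0<..}. w < 1 \<and> y \<le> w - 1 - ln w" for y :: real by (rule W_below)
    show "\<exists>w\<in>{0<..}. 1 < w \<and> y \<le> w - 1 - ln w" for y :: real by (rule W_above)
  qed (auto simp: is_interval_1 field_simps intro: that)
  let ?I = "{- (pi / 2)<..<pi / 2}"
  have cos_pos: "cos x > 0" if "x \<in> ?I" for x
    using that by (simp add: cos_gt_zero_pi)
  have Phi_above: "\<exists>x\<in>?I. 0 < x \<and> y \<le> - q * ln (cos x)" for y
  proof -
    \<comment> \<open>Solves -q ln u = \<open>\<bar>y\<bar> + 1\<close>; the added 1 keeps
      \<open>u\<close> below 1 and its arccosine positive.\<close>
    define u where "u = exp (- (\<bar>y\<bar> + 1) / q)"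
    have u: "0 < u" "u < 1" using q by (simp_all add: u_def divide_neg_pos)
    have "0 < arccos u" "arccos u < pi / 2"
      using u arccos_less_arccos[of u 1] arccos_less_arccos[of 0 u] by auto
    moreover have "cos (arccos u) = u" using u by simp
    moreover have "- q * ln u = \<bar>y\<bar> + 1"
      using q by (simp add: u_def)
    ultimately show ?thesis by (intro bexI[of _ "arccos u"]) auto
  qed
  have Phi_below: "\<exists>x\<in>?I. x < 0 \<and> y \<le> - q * ln (cos x)" for y
  proof -
    obtain x where "x \<in> ?I" "0 < x" "y \<le> - q * ln (cos x)" using Phi_above by blast
    then show ?thesis by (intro bexI[of _ "- x"]) auto
  qed
  obtain \<Phi> E where P: "\<And>x. \<Phi> x \<in> ?I" "\<And>x. (\<Phi> has_real_derivative E x) (at x)" "\<And>x. 0 < E x"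
    "continuous_on UNIV E" "\<And>x. - q * ln (cos (\<Phi> x)) = x\<^sup>2 / 2" "\<And>x. q * tan (\<Phi> x) * E x = x"
    "\<Phi> 0 = 0" "E 0 = 1 / sqrt (q / (cos 0)\<^sup>2)"
  proof (rule morse_coordinate[where I = ?I and c = 0 and A = "\<lambda>x. - q * ln (cos x)"
        and dA = "\<lambda>x. q * tan x" and ddA = "\<lambda>x. q / (cos x)\<^sup>2"])
    show "((\<lambda>x. - q * ln (cos x)) has_real_derivative q * tan x) (at x)" if "x \<in> ?I" for x
      using cos_pos[OF that] by (auto intro!: derivative_eq_intros simp: tan_def)
    show "((\<lambda>x. q * tan x) has_real_derivative q / (cos x)\<^sup>2) (at x)" if "x \<in> ?I" for x
      using cos_pos[OF that] by (auto intro!: derivative_eq_intros simp: field_simps)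
    show "isCont (\<lambda>x. q / (cos x)\<^sup>2) (0::real)"
      by (intro continuous_intros) simp
    show "q * tan x < 0" if "x \<in> ?I" "x < 0" for x
      using that q tan_gt_zero[of "- x"] by (simp add: mult_pos_neg)
    show "0 < q * tan x" if "x \<in> ?I" "0 < x" for x
      using that q tan_gt_zero[of x] by simp
    show "\<exists>x\<in>?I. x < 0 \<and> y \<le> - q * ln (cos x)" for y by (rule Phi_below)
    show "\<exists>x\<in>?I. 0 < x \<and> y \<le> - q * ln (cos x)" for y by (rule Phi_above)
  qed (use q in \<open>auto simp: is_interval_1 intro: that\<close>)
  have "oscillator q W D \<Phi> E"
  proof
    show "0 < W x" "- (pi / 2) < \<Phi> x" "\<Phi> x < pi / 2" for x
      using W(1)[of x] P(1)[of x] by auto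
    show "\<exists>x. W x = w" if "0 < w" for w
      using W(9) that by simp
    show "D 0 = 1" "E 0 = 1 / sqrt q"
      using W(8) P(8) by simp_all
  qed (rule q W P)+
  then show thesis by (rule that)
qed

section \<open>Selecting and counting the solutions\<close>

theorem theorem1p2:
  fixes q :: real
  assumes "q > 4"
  shows "\<exists>S :: (real \<Rightarrow> real) set.
           finite S \<and> int (card S) \<ge> \<lceil>sqrt q\<rceil> - 2 \<and>
           (\<forall>h\<in>S. positive_smooth_solution q h \<and> \<not> h constant_on UNIV) \<and>
           pairwise (\<lambda>h1 h2. \<not> rotation_of h1 h2) S"
proof -
  obtain W D \<Phi> E where osc: "oscillator q W D \<Phi> E"
    by (rule oscillator_exists[of q, OF _ that]) (use assms in simp)
  interpret oscillator q W D \<Phi> E by (rule osc)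
  \<comment> \<open>The range is what the intermediate value theorem reaches: k < sqrt q says that 2
    pi / k lies above \<open>period 0\<close>, and k >= 2 keeps it at most pi, below
    \<open>period R\<close>.\<close>
  define K where "K = {k::nat. 2 \<le> k \<and> real k < sqrt q}"
  have "\<exists>r>0. real k * period r = 2 * pi" if k: "k \<in> K" for k
  proof -
    obtain R where R: "0 < R" "pi < period R" using period_gt_pi by blast
    have k': "2 \<le> real k" "real k < sqrt q" using k by (auto simp: K_def)
    have "\<exists>r\<ge>0. r \<le> R \<and> period r = 2 * pi / k"
    proof (rule IVT')
      show "period 0 \<le> 2 * pi / k"
        using k' by (simp add: period_0 frac_le)
      have "2 * pi / k \<le> 2 * pi / 2"
        using k' by (intro divide_left_mono) auto
      then show "2 * pi / k \<le> period R" using R by simp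
      show "continuous_on {0..R} period"
        using continuous_period continuous_on_subset by blast
    qed (use R in simp)
    then obtain r where r: "0 \<le> r" "period r = 2 * pi / k" by blast
    \<comment> \<open>Strictness excludes the equilibrium r = 0, that is, the constant
      solution.\<close>
    have "period 0 < 2 * pi / k"
      using k' by (simp add: period_0 frac_less2)
    then have "r \<noteq> 0" using r by auto
    then show ?thesis using r k' by (intro exI[of _ r]) auto
  qed
  then obtain r where r: "\<And>k. k \<in> K \<Longrightarrow> 0 < r k \<and> real k * period (r k) = 2 * pi"
    by metis
  have "\<exists>h. positive_smooth_solution q h \<and> \<not> h constant_on UNIV \<and>
      (\<forall>x. h x \<le> W (r k) powr (1 / q)) \<and> (\<exists>x. h x = W (r k) powr (1 / q))" if "k \<in> K" for k
    by (rule solution_of_period[of "r k" k]) (use r[OF that] in blast)+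
  then obtain h where h: "\<And>k. k \<in> K \<Longrightarrow> positive_smooth_solution q (h k) \<and> \<not> h k constant_on UNIV \<and>
      (\<forall>x. h k x \<le> W (r k) powr (1 / q)) \<and> (\<exists>x. h k x = W (r k) powr (1 / q))"
    by metis
  \<comment> \<open>Rotations preserve the maximum, which determines \<open>r\<close> by strict
    monotonicity of \<open>W\<close>; then \<open>r\<close> determines \<open>k\<close> through k
    times the period being 2 pi.\<close>
  have distinct: "j = k" if jk: "j \<in> K" "k \<in> K" and rot: "rotation_of (h j) (h k)" for j k
  proof -
    obtain c where c: "\<And>x. h k x = h j (x + c)"
      using rot by (auto simp: rotation_of_def)
    obtain x y where xy: "h k x = W (r k) powr (1 / q)" "h j y = W (r j) powr (1 / q)"
      using h jk by metis
    have "W (r k) powr (1 / q) \<le> W (r j) powr (1 / q)"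
      using h[OF jk(1)] c[of x] xy(1) by metis
    moreover have "W (r j) powr (1 / q) \<le> W (r k) powr (1 / q)"
      using h[OF jk(2)] c[of "y - c"] xy(2) by (metis diff_add_cancel)
    moreover have "W u powr (1 / q) < W v powr (1 / q)" if "u < v" for u v
      using that q_pos W_pos by (intro powr_less_mono2 W_less) (auto simp: less_imp_le)
    ultimately have "r j = r k"
      by (meson linorder_neqE leD)
    then show "j = k"
      using r[OF jk(1)] r[OF jk(2)] by (metis mult_cancel_right of_nat_eq_iff mult_zero_right pi_neq_zero mult_eq_0_iff zero_neq_numeral)
  qed
  \<comment> \<open>Equal functions are rotations of each other by 0.\<close>
  have "inj_on h K"
  proof (rule inj_onI)
    fix j k assume "j \<in> K" "k \<in> K" "h j = h k"
    then show "j = k"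
      by (intro distinct) (auto simp: rotation_of_def intro: exI[of _ 0])
  qed
  \<comment> \<open>For an integer k, k < sqrt q is equivalent to k <
    \<open>\<lceil>sqrt q\<rceil>\<close>, also when sqrt q is an integer.\<close>
  have K_eq: "K = {2..<nat \<lceil>sqrt q\<rceil>}"
    by (auto simp: K_def less_ceiling_iff zless_nat_eq_int_zless)
  have "finite (h ` K)" by (simp add: K_eq)
  moreover have "int (card (h ` K)) \<ge> \<lceil>sqrt q\<rceil> - 2"
    unfolding card_image[OF \<open>inj_on h K\<close>] by (simp add: K_eq)
  moreover have "\<forall>g\<in>h ` K. positive_smooth_solution q g \<and> \<not> g constant_on UNIV"
    using h by blast
  moreover have "pairwise (\<lambda>h1 h2. \<not> rotation_of h1 h2) (h ` K)"
    unfolding pairwise_def using distinct by blast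
  ultimately show ?thesis by blast
qed

end
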